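(* For any graph $G$ of maximum degree $\Delta(G)$, we have that $\mathrm{sn}(G)\leq (\mathrm{tw}(G)+1)\,\Delta(G)$.
   Context: A graph is a finite, connected, loopless multigraph (multiple edges allowed). The treewidth $\mathrm{tw}(G)$ is the usual treewidth of $G$; equivalently, $\mathrm{tw}(G)=\mathrm{bn}(G)-1$, where the bramble number $\mathrm{bn}(G)$ is the maximum, over all collections $\mathcal{B}$ of nonempty connected subgraphs of $G$ any two of which intersect or are joined by an edge, of the minimum size of a set of vertices meeting every member of $\mathcal{B}$. A scramble $\mathcal{S}$ on $G$ is a nonempty collection (set) of nonempty connected subgraphs of $G$, called eggs. The hitting number $h(\mathcal{S})$ is the minimum size of a set of vertices meeting the vertex set of every egg. An egg-cut is a set of edges whose deletion disconnects $G$ so that two different components each contain an egg; the egg-cut number $e(\mathcal{S})$ is the minimum size of an egg-cut, with $e(\mathcal{S})=\infty$ if none exists. The order is $\|\mathcal{S}\|=\min\{h(\mathcal{S}),e(\mathcal{S})\}$. The scramble number $\mathrm{sn}(G)$ is the maximum order of a scramble on $G$.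
   Formalization: The graph is assumed to have at least two vertices: for the one-vertex graph the scramble number is 1 while the treewidth and the maximum degree are both 0, so the stated bound fails there; no other graph is excluded. *)

theory Defs
  imports Main "HOL-Library.Extended_Nat"
begin

text \<open>Multigraphs: edges are abstract objects, so parallel edges are distinct
  elements with equal endpoint sets. Loops are excluded by requiring two
  distinct endpoints.\<close>

record ('v, 'e) mgraph =
  verts :: "'v set"
  edges :: "'e set"
  ends :: "'e \<Rightarrow> 'v set"

definition multigraph :: "('v, 'e) mgraph \<Rightarrow> bool" where
  "multigraph G \<longleftrightarrow> finite (verts G) \<and> finite (edges G) \<and>
     (\<forall>e\<in>edges G. ends G e \<subseteq> verts G \<and> card (ends G e) = 2)"

text \<open>Subgraphs carry the same total function \<open>ends\<close> as the host graph, so that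
  a subgraph is determined by its vertices and edges.\<close>

definition subgraph :: "('v, 'e) mgraph \<Rightarrow> ('v, 'e) mgraph \<Rightarrow> bool" where
  "subgraph H G \<longleftrightarrow> multigraph H \<and> verts H \<subseteq> verts G \<and> edges H \<subseteq> edges G \<and> ends H = ends G"

definition adj :: "('v, 'e) mgraph \<Rightarrow> ('v \<times> 'v) set" where
  "adj G = {(u, v). \<exists>e\<in>edges G. ends G e = {u, v}}"

text \<open>The empty graph does not count as connected.\<close>

definition connected_graph :: "('v, 'e) mgraph \<Rightarrow> bool" where
  "connected_graph G \<longleftrightarrow> verts G \<noteq> {} \<and> (\<forall>u\<in>verts G. \<forall>v\<in>verts G. (u, v) \<in> (adj G)\<^sup>*)"

definition graph :: "('v, 'e) mgraph \<Rightarrow> bool" where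
  "graph G \<longleftrightarrow> multigraph G \<and> connected_graph G"

definition component :: "('v, 'e) mgraph \<Rightarrow> ('v, 'e) mgraph \<Rightarrow> bool" where
  "component C G \<longleftrightarrow> subgraph C G \<and> connected_graph C \<and>
     (\<forall>D. subgraph D G \<and> connected_graph D \<and> subgraph C D \<longrightarrow> D = C)"

definition delete_edges :: "('v, 'e) mgraph \<Rightarrow> 'e set \<Rightarrow> ('v, 'e) mgraph" where
  "delete_edges G F = G\<lparr>edges := edges G - F\<rparr>"

definition induced :: "('v, 'e) mgraph \<Rightarrow> 'v set \<Rightarrow> ('v, 'e) mgraph" where
  "induced G X = G\<lparr>verts := X, edges := {e \<in> edges G. ends G e \<subseteq> X}\<rparr>"

definition degree :: "('v, 'e) mgraph \<Rightarrow> 'v \<Rightarrow> nat" where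
  "degree G v = card {e \<in> edges G. v \<in> ends G e}"

definition max_degree :: "('v, 'e) mgraph \<Rightarrow> nat" where
  "max_degree G = Max (degree G ` verts G)"


subsection \<open>Treewidth\<close>

text \<open>A cycle is given by its cyclic sequences of vertices and edges; two parallel
  edges form a cycle of length two.\<close>

definition cycle :: "('v, 'e) mgraph \<Rightarrow> 'v list \<Rightarrow> 'e list \<Rightarrow> bool" where
  "cycle G vs es \<longleftrightarrow> length vs \<ge> 2 \<and> length es = length vs \<and> distinct vs \<and> distinct es \<and>
     set vs \<subseteq> verts G \<and> set es \<subseteq> edges G \<and>
     (\<forall>i<length vs. ends G (es ! i) = {vs ! i, vs ! (Suc i mod length vs)})"

definition tree :: "('v, 'e) mgraph \<Rightarrow> bool" where
  "tree T \<longleftrightarrow> multigraph T \<and> connected_graph T \<and> (\<nexists>vs es. cycle T vs es)"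

definition tree_decomposition ::
    "('v, 'e) mgraph \<Rightarrow> ('t, 'f) mgraph \<Rightarrow> ('t \<Rightarrow> 'v set) \<Rightarrow> bool" where
  "tree_decomposition G T bag \<longleftrightarrow> tree T \<and>
     (\<Union>t\<in>verts T. bag t) = verts G \<and>
     (\<forall>e\<in>edges G. \<exists>t\<in>verts T. ends G e \<subseteq> bag t) \<and>
     (\<forall>v\<in>verts G. connected_graph (induced T {t \<in> verts T. v \<in> bag t}))"

definition width :: "('t, 'f) mgraph \<Rightarrow> ('t \<Rightarrow> 'v set) \<Rightarrow> nat" where
  "width T bag = Max ((\<lambda>t. card (bag t)) ` verts T) - 1"

text \<open>Trees are finite, so it is no restriction to take natural numbers as names
  for the nodes and edges of the decomposition tree.\<close>

definition treewidth :: "('v, 'e) mgraph \<Rightarrow> nat" where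
  "treewidth G = (LEAST w. \<exists>(T :: (nat, nat) mgraph) bag.
     tree_decomposition G T bag \<and> width T bag = w)"


subsection \<open>Scrambles\<close>

definition scramble :: "('v, 'e) mgraph \<Rightarrow> ('v, 'e) mgraph set \<Rightarrow> bool" where
  "scramble G S \<longleftrightarrow> S \<noteq> {} \<and> (\<forall>A\<in>S. subgraph A G \<and> connected_graph A)"

definition hitting_set :: "('v, 'e) mgraph \<Rightarrow> ('v, 'e) mgraph set \<Rightarrow> 'v set \<Rightarrow> bool" where
  "hitting_set G S X \<longleftrightarrow> X \<subseteq> verts G \<and> (\<forall>A\<in>S. X \<inter> verts A \<noteq> {})"

definition hitting_number :: "('v, 'e) mgraph \<Rightarrow> ('v, 'e) mgraph set \<Rightarrow> nat" where
  "hitting_number G S = (LEAST n. \<exists>X. hitting_set G S X \<and> card X = n)"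

definition egg_cut :: "('v, 'e) mgraph \<Rightarrow> ('v, 'e) mgraph set \<Rightarrow> 'e set \<Rightarrow> bool" where
  "egg_cut G S F \<longleftrightarrow> F \<subseteq> edges G \<and>
     (\<exists>C D. component C (delete_edges G F) \<and> component D (delete_edges G F) \<and> C \<noteq> D \<and>
        (\<exists>A\<in>S. subgraph A C) \<and> (\<exists>B\<in>S. subgraph B D))"

text \<open>The infimum of the empty set in \<^typ>\<open>enat\<close> is \<open>\<infinity>\<close>, which is the value
  wanted when there is no egg-cut.\<close>

definition egg_cut_number :: "('v, 'e) mgraph \<Rightarrow> ('v, 'e) mgraph set \<Rightarrow> enat" where
  "egg_cut_number G S = (INF F\<in>{F. egg_cut G S F}. enat (card F))"

definition scramble_order :: "('v, 'e) mgraph \<Rightarrow> ('v, 'e) mgraph set \<Rightarrow> enat" where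
  "scramble_order G S = min (enat (hitting_number G S)) (egg_cut_number G S)"

definition scramble_number :: "('v, 'e) mgraph \<Rightarrow> enat" where
  "scramble_number G = Max (scramble_order G ` {S. scramble G S})"


text \<open>The extrema above are taken over the sets they should be: the maximum is over a
  finite nonempty set, and the minima are over nonempty sets.\<close>

lemma finite_scrambles:
  assumes "multigraph G"
  shows "finite {S. scramble G S}"
proof -
  have "H \<in> (\<lambda>(X, F). \<lparr>verts = X, edges = F, ends = ends G\<rparr>) ` (Pow (verts G) \<times> Pow (edges G))"
    if "subgraph H G" for H
    using that by (intro image_eqI[of _ _ "(verts H, edges H)"]) (auto simp: subgraph_def)
  then have "{H. subgraph H G} \<subseteq>
      (\<lambda>(X, F). \<lparr>verts = X, edges = F, ends = ends G\<rparr>) ` (Pow (verts G) \<times> Pow (edges G))"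
    by blast
  moreover have "finite (Pow (verts G) \<times> Pow (edges G))"
    using assms by (simp add: multigraph_def)
  ultimately have "finite {H. subgraph H G}"
    by (meson finite_imageI finite_subset)
  moreover have "{S. scramble G S} \<subseteq> Pow {H. subgraph H G}"
    by (auto simp: scramble_def)
  ultimately show ?thesis
    by (meson finite_Pow_iff finite_subset)
qed

lemma scramble_exists:
  assumes "graph G"
  shows "scramble G {G}"
  using assms by (simp add: scramble_def graph_def subgraph_def)

lemma hitting_set_exists:
  assumes "scramble G S"
  shows "hitting_set G S (verts G)"
  using assms unfolding scramble_def hitting_set_def subgraph_def connected_graph_def by blast

lemma tree_decomposition_exists:
  assumes "graph G"
  shows "tree_decomposition G
    (\<lparr>verts = {0}, edges = {}, ends = (\<lambda>_. {})\<rparr> :: (nat, nat) mgraph) (\<lambda>_. verts G)"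
  using assms
  by (auto simp: tree_decomposition_def tree_def multigraph_def connected_graph_def cycle_def
      induced_def graph_def)

end

theory Submission imports Defs begin

text \<open>Fix a tree decomposition of width \<open>w\<close> and a scramble. Either some bag meets every egg, so
  the hitting number is at most \<open>w + 1\<close>, or every node \<open>t\<close> points along a tree edge towards
  an egg avoiding its bag. Some edge \<open>t t'\<close> of the finite tree is then used in both directions:
  there are eggs \<open>A\<close> and \<open>B\<close> lying on opposite sides of it, with \<open>A\<close> avoiding the bag of \<open>t\<close>
  and \<open>B\<close> that of \<open>t'\<close>. Both avoid the intersection \<open>Z\<close> of the two bags, which separates them.
  So the edges incident with \<open>Z\<close>, of which there are at most \<open>(w + 1) \<Delta>(G)\<close>, form an egg-cut.\<close>

subsection \<open>Paths and components\<close>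

lemma sym_adj: "sym (adj G)"
  by (auto simp: sym_def adj_def insert_commute)

lemma adj_rtrancl_sym: "(u, v) \<in> (adj G)\<^sup>* \<Longrightarrow> (v, u) \<in> (adj G)\<^sup>*"
  using sym_rtrancl[OF sym_adj] by (rule symD)

lemma adj_delete_edges:
  "(u, v) \<in> adj (delete_edges G F) \<longleftrightarrow> (\<exists>e\<in>edges G - F. ends G e = {u, v})"
  by (simp add: adj_def delete_edges_def)

text \<open>An invariant principle: to confine everything reachable from \<open>u\<close> to
  \<open>X\<close>, it suffices that no edge leaves \<open>X\<close>. The later confinement
  arguments for sides and parts use this form or its variant for connected graphs.\<close>

lemma adj_rtrancl_closed:
  assumes "(u, v) \<in> (adj G)\<^sup>*" "u \<in> X"
    and "\<And>e x y. e \<in> edges G \<Longrightarrow> ends G e = {x, y} \<Longrightarrow> x \<in> X \<Longrightarrow> y \<in> X"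
  shows "v \<in> X"
  using assms(1)
proof induction
  case (step y z)
  then obtain e where "e \<in> edges G" "ends G e = {y, z}" by (auto simp: adj_def)
  then show ?case using step.IH by (rule assms(3))
qed (rule assms(2))

lemma connected_graph_closed:
  assumes "connected_graph H" "u \<in> verts H" "u \<in> X"
    and "\<And>e x y. e \<in> edges H \<Longrightarrow> ends H e = {x, y} \<Longrightarrow> x \<in> X \<Longrightarrow> y \<in> X"
  shows "verts H \<subseteq> X"
proof
  fix v assume "v \<in> verts H"
  then have "(u, v) \<in> (adj H)\<^sup>*" using assms(1,2) by (auto simp: connected_graph_def)
  then show "v \<in> X" using assms(3,4) by (rule adj_rtrancl_closed)
qed

lemma multigraph_delete_edges: "multigraph G \<Longrightarrow> multigraph (delete_edges G F)"
  by (auto simp: multigraph_def delete_edges_def)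

lemma adj_mono_subgraph: "subgraph H G \<Longrightarrow> adj H \<subseteq> adj G"
  unfolding adj_def subgraph_def by auto

lemma subgraph_ends_subset:
  "subgraph A G \<Longrightarrow> e \<in> edges A \<Longrightarrow> ends G e \<subseteq> verts A"
  by (metis multigraph_def subgraph_def)

lemma subgraph_reachable:
  assumes "connected_graph A" "subgraph A G" "a \<in> verts A"
  shows "subgraph A (induced G {v \<in> verts G. (a, v) \<in> (adj G)\<^sup>*})"
proof -
  have "(a, v) \<in> (adj G)\<^sup>*" if "v \<in> verts A" for v
    using assms that rtrancl_mono[OF adj_mono_subgraph[OF assms(2)]]
    by (auto simp: connected_graph_def)
  moreover have "ends G e \<subseteq> verts A" if "e \<in> edges A" for e
    using subgraph_ends_subset[OF assms(2) that] .
  ultimately show ?thesis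
    using assms(2) by (auto simp: subgraph_def induced_def)
qed

text \<open>Reachability classes induce components. For maximality, a connected \<open>D\<close>
  containing the class contains \<open>a\<close>, so all of \<open>D\<close> is reachable from
  \<open>a\<close> and \<open>D\<close> lies back inside the class.\<close>

lemma component_reachable:
  assumes "multigraph G" "a \<in> verts G"
  shows "component (induced G {v \<in> verts G. (a, v) \<in> (adj G)\<^sup>*}) G"
    (is "component ?C G")
proof -
  have mC: "multigraph ?C"
    using assms(1) by (auto simp: multigraph_def induced_def)
  then have sub: "subgraph ?C G"
    by (auto simp: subgraph_def induced_def)
  \<comment> \<open>Every vertex of a walk from \<open>a\<close> is itself reachable, so the walk
    never leaves \<open>?C\<close>.\<close>
  have reach: "(a, v) \<in> (adj ?C)\<^sup>*" if "(a, v) \<in> (adj G)\<^sup>*" for v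
    using that
  proof induction
    case (step y z)
    then obtain e where e: "e \<in> edges G" "ends G e = {y, z}" by (auto simp: adj_def)
    then have "y \<in> verts G" "z \<in> verts G" using assms(1) by (auto simp: multigraph_def)
    moreover have "(a, z) \<in> (adj G)\<^sup>*" using step by auto
    ultimately have "(y, z) \<in> adj ?C"
      using e step.hyps(1) by (auto simp: adj_def induced_def)
    then show ?case using step.IH by simp
  qed simp
  have "connected_graph ?C"
    unfolding connected_graph_def
  proof (intro conjI ballI)
    show "verts ?C \<noteq> {}" using assms(2) by (auto simp: induced_def)
    fix u v assume "u \<in> verts ?C" "v \<in> verts ?C"
    then have "(a, u) \<in> (adj ?C)\<^sup>*" "(a, v) \<in> (adj ?C)\<^sup>*"
      using reach by (auto simp: induced_def)
    then show "(u, v) \<in> (adj ?C)\<^sup>*" by (meson adj_rtrancl_sym rtrancl_trans)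
  qed
  moreover have "D = ?C"
    if D: "subgraph D G" "connected_graph D" "subgraph ?C D" for D
  proof -
    have "a \<in> verts D" using D(3) assms(2) by (auto simp: subgraph_def induced_def)
    then have "subgraph D ?C" by (rule subgraph_reachable[OF D(2,1)])
    with D(3) have "verts D = verts ?C" "edges D = edges ?C" "ends D = ends ?C"
      unfolding subgraph_def by blast+
    then show ?thesis by (intro mgraph.equality) simp_all
  qed
  ultimately show ?thesis using sub by (auto simp: component_def)
qed

text \<open>Replaces the search for two components by a failure of reachability: the classes of
  \<open>a\<close> and \<open>b\<close> are components containing the two eggs, and they differ
  because \<open>b\<close> lies only in its own.\<close>

lemma egg_cutI:
  assumes G: "multigraph G" and F: "F \<subseteq> edges G"
    and A: "A \<in> S" "connected_graph A" "subgraph A (delete_edges G F)" "a \<in> verts A"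
    and B: "B \<in> S" "connected_graph B" "subgraph B (delete_edges G F)" "b \<in> verts B"
    and sep: "(a, b) \<notin> (adj (delete_edges G F))\<^sup>*"
  shows "egg_cut G S F"
proof -
  let ?H = "delete_edges G F"
  let ?C = "\<lambda>c. induced ?H {v \<in> verts ?H. (c, v) \<in> (adj ?H)\<^sup>*}"
  have H: "multigraph ?H" using G by (rule multigraph_delete_edges)
  have ab: "a \<in> verts ?H" "b \<in> verts ?H" using A B by (auto simp: subgraph_def)
  have "b \<in> verts (?C b)" "b \<notin> verts (?C a)" using ab sep by (auto simp: induced_def)
  then have "?C a \<noteq> ?C b" by metis
  moreover have "component (?C a) ?H" "component (?C b) ?H"
    using component_reachable[OF H] ab by auto
  moreover have "subgraph A (?C a)" "subgraph B (?C b)"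
    using subgraph_reachable[OF A(2,3,4)] subgraph_reachable[OF B(2,3,4)] by auto
  ultimately show ?thesis using F A(1) B(1) unfolding egg_cut_def by blast
qed

subsection \<open>Trees\<close>

text \<open>Reachability is turned into explicit vertex and edge lists with distinct vertices, the
  format that \<open>cycle\<close> requires.\<close>

lemma simple_path:
  assumes "multigraph G" "u \<in> verts G" "(u, v) \<in> (adj G)\<^sup>*"
  shows "\<exists>vs es. length vs = Suc (length es) \<and> distinct vs \<and> vs ! 0 = u \<and> vs ! length es = v \<and>
    set vs \<subseteq> verts G \<and> set es \<subseteq> edges G \<and>
    (\<forall>i<length es. ends G (es ! i) = {vs ! i, vs ! Suc i})"
  using assms(3)
proof induction
  case base
  show ?case using assms(2) by (intro exI[of _ "[u]"] exI[of _ "[]"]) auto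
next
  case (step y z)
  then obtain vs es where p: "length vs = Suc (length es)" "distinct vs" "vs ! 0 = u"
    "vs ! length es = y" "set vs \<subseteq> verts G" "set es \<subseteq> edges G"
    "\<forall>i<length es. ends G (es ! i) = {vs ! i, vs ! Suc i}" by blast
  obtain e where e: "e \<in> edges G" "ends G e = {y, z}" using step(2) by (auto simp: adj_def)
  then have z: "z \<in> verts G" using assms(1) by (auto simp: multigraph_def)
  show ?case
  proof (cases "z \<in> set vs")
    case True
    then obtain j where j: "j < length vs" "vs ! j = z" by (auto simp: in_set_conv_nth)
    \<comment> \<open>The walk returns to \<open>z\<close>, so the path is cut back to its prefix
      ending there.\<close>
    then show ?thesis
      using p set_take_subset[of "Suc j" vs] set_take_subset[of j es]
      by (intro exI[of _ "take (Suc j) vs"] exI[of _ "take j es"]) auto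
  next
    case False
    then show ?thesis
      using p e z
      by (intro exI[of _ "vs @ [z]"] exI[of _ "es @ [e]"]) (auto simp: nth_append less_Suc_eq)
  qed
qed

text \<open>A simple path from \<open>s\<close> to \<open>t\<close> avoiding \<open>f\<close> would
  be closed by \<open>f\<close> to a cycle. If the path has a single edge, this is the cycle of
  length two formed by parallel edges.\<close>

lemma tree_edge_bridge:
  assumes T: "tree T" and f: "f \<in> edges T" "ends T f = {s, t}"
  shows "(s, t) \<notin> (adj (delete_edges T {f}))\<^sup>*"
proof
  let ?H = "delete_edges T {f}"
  assume r: "(s, t) \<in> (adj ?H)\<^sup>*"
  have mT: "multigraph T" using T by (simp add: tree_def)
  have s: "s \<in> verts ?H" and st: "s \<noteq> t"
    using mT f by (auto simp: multigraph_def delete_edges_def)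
  obtain vs es where p: "length vs = Suc (length es)" "distinct vs" "vs ! 0 = s"
    "vs ! length es = t" "set vs \<subseteq> verts T" "set es \<subseteq> edges T - {f}"
    "\<forall>i<length es. ends T (es ! i) = {vs ! i, vs ! Suc i}"
    using simple_path[OF multigraph_delete_edges[OF mT] s r] by (auto simp: delete_edges_def)
  have ne: "es \<noteq> []" using p st by auto
  have "i = j" if "i < length es" "j < length es" "es ! i = es ! j" for i j
  proof -
    have "{vs ! i, vs ! Suc i} = {vs ! j, vs ! Suc j}" using p(7) that by metis
    then have "vs ! i = vs ! j \<or> vs ! i = vs ! Suc j \<and> vs ! Suc i = vs ! j"
      by (auto simp: doubleton_eq_iff)
    \<comment> \<open>As the vertices are distinct, the crossed case would force both
      \<open>i = Suc j\<close> and \<open>j = Suc i\<close>.\<close>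
    then show ?thesis using that p(1,2) by (auto simp: nth_eq_iff_index_eq)
  qed
  then have "distinct es" by (auto simp: distinct_conv_nth)
  moreover have "ends T ((es @ [f]) ! i) = {vs ! i, vs ! (Suc i mod length vs)}"
    if "i < length vs" for i
  proof (cases "i < length es")
    case True
    then show ?thesis using p by (simp add: nth_append)
  next
    case False
    then have "i = length es" using that p(1) by simp
    \<comment> \<open>Here \<open>Suc i mod length vs\<close> wraps to \<open>0\<close>: the last
      edge \<open>f\<close> leads from \<open>t\<close> back to \<open>s\<close>.\<close>
    then show ?thesis using p f by (simp add: insert_commute)
  qed
  ultimately have "cycle T vs (es @ [f])"
    using p ne f unfolding cycle_def by (auto simp: Suc_le_eq)
  then show False using T by (auto simp: tree_def)
qed

text \<open>For a node \<open>t\<close> of a tree, this is the node set of the component of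
  \<open>T - f\<close> containing \<open>t\<close>.\<close>

definition side :: "('t, 'f) mgraph \<Rightarrow> 'f \<Rightarrow> 't \<Rightarrow> 't set" where
  "side T f t = {s. (t, s) \<in> (adj (delete_edges T {f}))\<^sup>*}"

lemma side_refl [simp]: "t \<in> side T f t"
  by (simp add: side_def)

lemma side_step:
  assumes "x \<in> side T f t" "e \<in> edges T" "e \<noteq> f" "ends T e = {x, y}"
  shows "y \<in> side T f t"
proof -
  have "(x, y) \<in> adj (delete_edges T {f})" using assms by (auto simp: adj_delete_edges)
  with assms(1) show ?thesis unfolding side_def mem_Collect_eq by (rule rtrancl_into_rtrancl)
qed

lemma side_subset_verts:
  assumes "multigraph T" "t \<in> verts T"
  shows "side T f t \<subseteq> verts T"
proof
  fix s assume "s \<in> side T f t"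
  then have "(t, s) \<in> (adj (delete_edges T {f}))\<^sup>*" by (simp add: side_def)
  then show "s \<in> verts T"
    by (rule adj_rtrancl_closed)
      (use assms in \<open>auto simp: delete_edges_def multigraph_def\<close>)
qed

lemma side_disjoint:
  assumes "tree T" "f \<in> edges T" "ends T f = {s, t}"
  shows "side T f s \<inter> side T f t = {}"
proof (rule ccontr)
  assume "side T f s \<inter> side T f t \<noteq> {}"
  then have "(s, t) \<in> (adj (delete_edges T {f}))\<^sup>*"
    by (auto simp: side_def dest: adj_rtrancl_sym intro: rtrancl_trans)
  then show False using tree_edge_bridge[OF assms] by simp
qed

text \<open>Along a walk from \<open>t\<close> to \<open>s\<close>, take the edge by which it leaves
  \<open>t\<close> for the last time. Later edges are not incident with \<open>t\<close>, hence
  differ from \<open>f\<close> and stay on the far side.\<close>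

lemma side_towards:
  assumes "(t, s) \<in> (adj T)\<^sup>*" "s \<noteq> t"
  shows "\<exists>f\<in>edges T. \<exists>t'. ends T f = {t, t'} \<and> s \<in> side T f t'"
  using assms
proof induction
  case (step y z)
  obtain g where g: "g \<in> edges T" "ends T g = {y, z}" using step by (auto simp: adj_def)
  show ?case
  proof (cases "y = t")
    case True
    then show ?thesis using g side_refl by metis
  next
    case False
    then obtain f t' where f: "f \<in> edges T" "ends T f = {t, t'}" "y \<in> side T f t'"
      using step by auto
    have "g \<noteq> f" using g f False step.prems by (auto simp: doubleton_eq_iff)
    then show ?thesis using f g side_step by metis
  qed
qed simp

text \<open>Moving on along a new edge shrinks the far side: it loses \<open>t'\<close>. A walk from
  \<open>t''\<close> avoiding \<open>g\<close> never meets \<open>t'\<close>, so it cannot use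
  \<open>f\<close> either.\<close>

lemma side_psubset:
  assumes T: "tree T" and f: "f \<in> edges T" "ends T f = {t, t'}"
    and g: "g \<in> edges T" "ends T g = {t', t''}" and "g \<noteq> f"
  shows "side T g t'' \<subset> side T f t'"
proof -
  have t': "t' \<notin> side T g t''" using side_disjoint[OF T g] side_refl[of t' T g] by blast
  have "side T g t'' \<subseteq> side T f t' \<inter> side T g t''"
  proof
    fix s assume "s \<in> side T g t''"
    then have "(t'', s) \<in> (adj (delete_edges T {g}))\<^sup>*" by (simp add: side_def)
    then show "s \<in> side T f t' \<inter> side T g t''"
    proof (rule adj_rtrancl_closed)
      show "t'' \<in> side T f t' \<inter> side T g t''"
        using side_step[OF side_refl g(1) \<open>g \<noteq> f\<close> g(2)] by simp
    next
      fix e x y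
      assume e: "e \<in> edges (delete_edges T {g})" "ends (delete_edges T {g}) e = {x, y}"
        and x: "x \<in> side T f t' \<inter> side T g t''"
      then have e': "e \<in> edges T" "e \<noteq> g" "ends T e = {x, y}" by (auto simp: delete_edges_def)
      then have y: "y \<in> side T g t''" using x side_step by (metis IntD2)
      have "e \<noteq> f" using e' f t' x y by auto
      then show "y \<in> side T f t' \<inter> side T g t''" using e' x y side_step by (metis IntD1 IntI)
    qed
  qed
  then show ?thesis using t' side_refl[of t' T f] by blast
qed

lemma connected_subset_side:
  assumes "connected_graph (induced T X)" "\<not> ends T f \<subseteq> X" "s \<in> X" "s \<in> side T f t"
  shows "X \<subseteq> side T f t"
proof -
  have "verts (induced T X) \<subseteq> side T f t"
    using assms(1)
  proof (rule connected_graph_closed[where u = s])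
    fix e x y
    assume "e \<in> edges (induced T X)" "ends (induced T X) e = {x, y}" and x: "x \<in> side T f t"
    then have e: "e \<in> edges T" "ends T e = {x, y}" "ends T e \<subseteq> X" by (auto simp: induced_def)
    then have "e \<noteq> f" using assms(2) by metis
    then show "y \<in> side T f t" using side_step[OF x e(1) _ e(2)] by simp
  qed (use assms in \<open>auto simp: induced_def\<close>)
  then show ?thesis by (simp add: induced_def)
qed

subsection \<open>Separations of a tree decomposition\<close>

text \<open>The vertices strictly on one side of the separation given by \<open>f\<close>. In a tree
  decomposition, vertices common to the bags at both ends of \<open>f\<close> lie in neither
  part.\<close>

definition part :: "('v, 'e) mgraph \<Rightarrow> ('t, 'f) mgraph \<Rightarrow> ('t \<Rightarrow> 'v set) \<Rightarrow> 'f \<Rightarrow> 't \<Rightarrow> 'v set" where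
  "part G T bag f t = {v \<in> verts G. {s \<in> verts T. v \<in> bag s} \<subseteq> side T f t}"

lemma part_disjoint:
  assumes td: "tree_decomposition G T bag" and f: "f \<in> edges T" "ends T f = {t, t'}"
  shows "part G T bag f t \<inter> part G T bag f t' = {}"
proof -
  have "side T f t \<inter> side T f t' = {}"
    using td f by (intro side_disjoint) (auto simp: tree_decomposition_def)
  \<comment> \<open>Without a bag containing it, a vertex would lie in both parts vacuously.\<close>
  moreover have "\<exists>s\<in>verts T. v \<in> bag s" if "v \<in> verts G" for v
    using td that by (auto simp: tree_decomposition_def)
  ultimately show ?thesis unfolding part_def by blast
qed

text \<open>The nodes whose bags contain \<open>v\<close> induce a connected subgraph. Since
  \<open>v\<close> misses the bag of an end of \<open>f\<close>, this subgraph does not contain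
  \<open>f\<close>, so one node fixes the side of all.\<close>

lemma partI:
  assumes td: "tree_decomposition G T bag" and f: "f \<in> edges T" "ends T f = {t, t'}"
    and v: "v \<in> verts G" "v \<notin> bag t \<inter> bag t'" and s: "s \<in> verts T" "v \<in> bag s" "s \<in> side T f t'"
  shows "v \<in> part G T bag f t'"
proof -
  have "connected_graph (induced T {s \<in> verts T. v \<in> bag s})"
    using td v by (auto simp: tree_decomposition_def)
  then have "{s \<in> verts T. v \<in> bag s} \<subseteq> side T f t'"
    by (rule connected_subset_side) (use f v s in auto)
  then show ?thesis using v by (simp add: part_def)
qed

text \<open>The separation property: some bag contains both ends of the edge, and its node puts
  \<open>v\<close> on the same side as \<open>u\<close>.\<close>

lemma part_step:
  assumes td: "tree_decomposition G T bag" and G: "multigraph G"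
    and f: "f \<in> edges T" "ends T f = {t, t'}"
    and e: "e \<in> edges G" "ends G e = {u, v}" "v \<notin> bag t \<inter> bag t'"
    and u: "u \<in> part G T bag f t'"
  shows "v \<in> part G T bag f t'"
proof -
  obtain s where s: "s \<in> verts T" "{u, v} \<subseteq> bag s"
    using td e by (auto simp: tree_decomposition_def)
  have "s \<in> side T f t'" using s u by (auto simp: part_def)
  moreover have "v \<in> verts G" using G e by (auto simp: multigraph_def)
  ultimately show ?thesis using partI[OF td f _ e(3)] s by auto
qed

text \<open>One vertex of the egg chooses the tree edge at \<open>t\<close>. The egg avoids
  \<open>bag t\<close>, hence also the intersection of the two bags, so by connectedness it cannot
  leave the chosen part.\<close>

lemma egg_towards:
  assumes td: "tree_decomposition G T bag" and G: "multigraph G"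
    and A: "subgraph A G" "connected_graph A" "verts A \<inter> bag t = {}" and t: "t \<in> verts T"
  shows "\<exists>f\<in>edges T. \<exists>t'. ends T f = {t, t'} \<and> verts A \<subseteq> part G T bag f t'"
proof -
  obtain v where v: "v \<in> verts A" "v \<in> verts G"
    using A unfolding connected_graph_def subgraph_def by blast
  then obtain s where s: "s \<in> verts T" "v \<in> bag s"
    using td unfolding tree_decomposition_def by blast
  then have "s \<noteq> t" using A(3) v by auto
  moreover have "(t, s) \<in> (adj T)\<^sup>*"
    using td s t by (auto simp: tree_decomposition_def tree_def connected_graph_def)
  ultimately obtain f t' where f: "f \<in> edges T" "ends T f = {t, t'}" "s \<in> side T f t'"
    using side_towards by metis
  have "v \<in> part G T bag f t'"
    using partI[OF td f(1,2) v(2) _ s f(3)] v A(3) by auto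
  with A(2) v(1) have "verts A \<subseteq> part G T bag f t'"
  proof (rule connected_graph_closed)
    fix e x y assume e: "e \<in> edges A" "ends A e = {x, y}" "x \<in> part G T bag f t'"
    then have "y \<in> verts A" "e \<in> edges G" "ends G e = {x, y}"
      using A(1) by (auto simp: subgraph_def multigraph_def)
    then show "y \<in> part G T bag f t'"
      using part_step[OF td G f(1,2)] e(3) A(3) by blast
  qed
  then show ?thesis using f by auto
qed

lemma bag_hits_or_eggs_separated:
  assumes td: "tree_decomposition G T bag" and G: "multigraph G" and S: "scramble G S"
  shows "(\<exists>t\<in>verts T. hitting_set G S (bag t)) \<or>
    (\<exists>f\<in>edges T. \<exists>t t'. \<exists>A\<in>S. \<exists>B\<in>S. ends T f = {t, t'} \<and>
      verts A \<inter> bag t = {} \<and> verts A \<subseteq> part G T bag f t' \<and>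
      verts B \<inter> bag t' = {} \<and> verts B \<subseteq> part G T bag f t)"
proof (cases "\<exists>t\<in>verts T. hitting_set G S (bag t)")
  case True
  then show ?thesis by blast
next
  case no: False
  have T: "tree T" and mT: "multigraph T" and "verts T \<noteq> {}"
    using td by (auto simp: tree_decomposition_def tree_def connected_graph_def)
  \<comment> \<open>A pointer: node \<open>t\<close> points along \<open>f\<close> to
    \<open>t'\<close>, towards an egg \<open>A\<close> that its bag misses.\<close>
  define Q where "Q = (\<lambda>(f, t, t', A). f \<in> edges T \<and> ends T f = {t, t'} \<and> A \<in> S \<and>
    verts A \<inter> bag t = {} \<and> verts A \<subseteq> part G T bag f t')"
  have step: "\<exists>f t' A. Q (f, t, t', A)" if t: "t \<in> verts T" for t
  proof -
    have "bag t \<subseteq> verts G" using td t by (auto simp: tree_decomposition_def)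
    then obtain A where A: "A \<in> S" "verts A \<inter> bag t = {}"
      using no t by (auto simp: hitting_set_def Int_commute)
    moreover have "subgraph A G" "connected_graph A" using S A by (auto simp: scramble_def)
    ultimately obtain f t' where
      "f \<in> edges T" "ends T f = {t, t'}" "verts A \<subseteq> part G T bag f t'"
      using egg_towards[OF td G _ _ _ t] by metis
    then have "Q (f, t, t', A)" using A by (simp add: Q_def)
    then show ?thesis by blast
  qed
  \<comment> \<open>A pointer with the fewest nodes on its far side is chosen; the pointer at its
    head must then run back along the same edge, as any other edge would give a smaller far
    side.\<close>
  define m where "m = (\<lambda>(f, t :: 'c, t', A :: ('a, 'b) mgraph). card (side T f t'))"
  obtain q where "Q q" using step \<open>verts T \<noteq> {}\<close> by (metis ex_in_conv)
  then have "\<exists>q. Q q \<and> (\<forall>r. Q r \<longrightarrow> m q \<le> m r)" by (rule ex_has_least_nat)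
  then obtain f t t' A where q: "Q (f, t, t', A)"
    and least: "\<And>r. Q r \<Longrightarrow> m (f, t, t', A) \<le> m r"
    by (metis prod_cases4)
  then have f: "f \<in> edges T" "ends T f = {t, t'}" by (auto simp: Q_def)
  then have t': "t' \<in> verts T" using mT by (auto simp: multigraph_def)
  then obtain g t'' B where r: "Q (g, t', t'', B)" using step by blast
  then have g: "g \<in> edges T" "ends T g = {t', t''}" by (auto simp: Q_def)
  have "g = f"
  proof (rule ccontr)
    assume "g \<noteq> f"
    then have "side T g t'' \<subset> side T f t'" using side_psubset[OF T f g] by simp
    moreover have "finite (side T f t')"
      using side_subset_verts[OF mT t'] mT by (auto simp: multigraph_def intro: finite_subset)
    ultimately have "card (side T g t'') < card (side T f t')" by (rule psubset_card_mono[rotated])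
    then show False using least[OF r] by (simp add: m_def)
  qed
  then have "t'' = t" using f g by (auto simp: doubleton_eq_iff)
  have A: "A \<in> S" "verts A \<inter> bag t = {}" "verts A \<subseteq> part G T bag f t'"
    using q by (auto simp: Q_def)
  have B: "B \<in> S" "verts B \<inter> bag t' = {}" "verts B \<subseteq> part G T bag f t"
    using r \<open>g = f\<close> \<open>t'' = t\<close> by (auto simp: Q_def)
  have "\<exists>t t'. \<exists>A\<in>S. \<exists>B\<in>S. ends T f = {t, t'} \<and>
      verts A \<inter> bag t = {} \<and> verts A \<subseteq> part G T bag f t' \<and>
      verts B \<inter> bag t' = {} \<and> verts B \<subseteq> part G T bag f t"
    by (rule exI[of _ t], rule exI[of _ t'], rule bexI[OF _ A(1)], rule bexI[OF _ B(1)])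
      (intro conjI f A B)
  then show ?thesis by (intro disjI2 bexI[OF _ f(1)])
qed

subsection \<open>The egg-cut of edges incident with a set of vertices\<close>

definition incident_edges :: "('v, 'e) mgraph \<Rightarrow> 'v set \<Rightarrow> 'e set" where
  "incident_edges G Z = {e \<in> edges G. ends G e \<inter> Z \<noteq> {}}"

lemma degree_le_max_degree:
  "multigraph G \<Longrightarrow> v \<in> verts G \<Longrightarrow> degree G v \<le> max_degree G"
  unfolding max_degree_def by (rule Max_ge) (auto simp: multigraph_def)

lemma card_incident_edges_le:
  assumes "multigraph G" "Z \<subseteq> verts G"
  shows "card (incident_edges G Z) \<le> card Z * max_degree G"
proof -
  have fin: "finite Z" using assms by (auto simp: multigraph_def intro: finite_subset)
  have "incident_edges G Z = (\<Union>v\<in>Z. {e \<in> edges G. v \<in> ends G e})"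
    by (auto simp: incident_edges_def)
  then have "card (incident_edges G Z) \<le> (\<Sum>v\<in>Z. degree G v)"
    using card_UN_le[OF fin] by (simp add: degree_def)
  also have "\<dots> \<le> card Z * max_degree G"
    using sum_bounded_above[of Z "degree G" "max_degree G"] degree_le_max_degree[OF assms(1)]
      assms(2) by (simp add: subset_iff)
  finally show ?thesis .
qed

text \<open>Serves the case of a bag hitting all eggs, where the bound \<open>w + 1\<close> carries
  no degree factor. For a single vertex the maximum degree is 0, but the scramble number is
  1.\<close>

lemma max_degree_pos:
  assumes "graph G" "card (verts G) \<ge> 2"
  shows "max_degree G \<ge> 1"
proof -
  have mG: "multigraph G" using assms(1) by (simp add: graph_def)
  obtain u v where uv: "u \<in> verts G" "v \<in> verts G" "u \<noteq> v"
    using assms(2) mG card_le_Suc0_iff_eq[of "verts G"] by (auto simp: multigraph_def)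
  then have "(u, v) \<in> (adj G)\<^sup>*" using assms(1) by (auto simp: graph_def connected_graph_def)
  then obtain y where "(u, y) \<in> adj G" using uv(3) by (auto elim: converse_rtranclE)
  then have "{e \<in> edges G. u \<in> ends G e} \<noteq> {}" by (auto simp: adj_def)
  then have "degree G u \<ge> 1"
    using mG by (simp add: degree_def multigraph_def Suc_le_eq card_gt_0_iff)
  then show ?thesis using degree_le_max_degree[OF mG uv(1)] by linarith
qed

lemma subgraph_delete_incident_edges:
  assumes "subgraph A G" "verts A \<inter> Z = {}"
  shows "subgraph A (delete_edges G (incident_edges G Z))"
proof -
  have "edges A \<inter> incident_edges G Z = {}"
    using subgraph_ends_subset[OF assms(1)] assms(2) by (fastforce simp: incident_edges_def)
  then show ?thesis using assms(1) by (auto simp: subgraph_def delete_edges_def)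
qed

lemma separated_egg_cut:
  assumes td: "tree_decomposition G T bag" and G: "multigraph G" and S: "scramble G S"
    and f: "f \<in> edges T" "ends T f = {t, t'}"
    and A: "A \<in> S" "verts A \<inter> bag t = {}" "verts A \<subseteq> part G T bag f t'"
    and B: "B \<in> S" "verts B \<inter> bag t' = {}" "verts B \<subseteq> part G T bag f t"
  shows "egg_cut G S (incident_edges G (bag t \<inter> bag t'))"
proof -
  let ?Z = "bag t \<inter> bag t'"
  let ?H = "delete_edges G (incident_edges G ?Z)"
  have AB: "subgraph A G" "connected_graph A" "subgraph B G" "connected_graph B"
    using S A(1) B(1) by (auto simp: scramble_def)
  obtain a b where a: "a \<in> verts A" and b: "b \<in> verts B"
    using AB by (auto simp: connected_graph_def)
  have "(a, b) \<notin> (adj ?H)\<^sup>*"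
  proof
    assume "(a, b) \<in> (adj ?H)\<^sup>*"
    \<comment> \<open>No remaining edge meets \<open>?Z\<close>, so \<open>part_step\<close> applies
      to each of them and nothing leaves the part containing \<open>a\<close>.\<close>
    then have "b \<in> part G T bag f t'"
    proof (rule adj_rtrancl_closed)
      fix e x y assume "e \<in> edges ?H" "ends ?H e = {x, y}" "x \<in> part G T bag f t'"
      then show "y \<in> part G T bag f t'"
        using part_step[OF td G f, of e x y] by (auto simp: delete_edges_def incident_edges_def)
    qed (use a A in auto)
    then show False using part_disjoint[OF td f] b B(3) by auto
  qed
  moreover have "verts A \<inter> ?Z = {}" "verts B \<inter> ?Z = {}" using A(2) B(2) by blast+
  then have "subgraph A ?H" "subgraph B ?H"
    using subgraph_delete_incident_edges AB(1,3) by metis+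
  moreover have "incident_edges G ?Z \<subseteq> edges G" by (auto simp: incident_edges_def)
  ultimately show ?thesis
    using egg_cutI[OF G _ A(1) AB(2) _ a B(1) AB(4) _ b] by metis
qed

section \<open>Bounding scramble orders by the width\<close>

lemma card_bag_le_width:
  assumes "tree_decomposition G T bag" "t \<in> verts T"
  shows "card (bag t) \<le> width T bag + 1"
proof -
  have "finite (verts T)" using assms by (auto simp: tree_decomposition_def tree_def multigraph_def)
  then have "card (bag t) \<le> Max ((\<lambda>t. card (bag t)) ` verts T)" using assms(2) by auto
  then show ?thesis by (simp add: width_def)
qed

lemma scramble_order_le_width:
  assumes td: "tree_decomposition G T bag" and G: "multigraph G" and S: "scramble G S"
    and deg: "max_degree G \<ge> 1"
  shows "scramble_order G S \<le> enat ((width T bag + 1) * max_degree G)"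
  using bag_hits_or_eggs_separated[OF td G S]
proof (elim disjE bexE exE conjE)
  \<comment> \<open>First case: the bag itself bounds the hitting number.\<close>
  fix t assume t: "t \<in> verts T" "hitting_set G S (bag t)"
  have "hitting_number G S \<le> card (bag t)"
    unfolding hitting_number_def by (rule Least_le) (use t in blast)
  also have "\<dots> \<le> (width T bag + 1) * 1" using card_bag_le_width[OF td t(1)] by simp
  also have "\<dots> \<le> (width T bag + 1) * max_degree G" using deg by (rule mult_le_mono2)
  finally show ?thesis by (auto simp: scramble_order_def intro: min.coboundedI1)
next
  \<comment> \<open>Second case: the edges incident with \<open>?Z\<close> bound the egg-cut
    number.\<close>
  fix f t t' A B
  assume f: "f \<in> edges T" "ends T f = {t, t'}"
    and A: "A \<in> S" "verts A \<inter> bag t = {}" "verts A \<subseteq> part G T bag f t'"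
    and B: "B \<in> S" "verts B \<inter> bag t' = {}" "verts B \<subseteq> part G T bag f t"
  let ?Z = "bag t \<inter> bag t'"
  have t: "t \<in> verts T" using td f by (auto simp: tree_decomposition_def tree_def multigraph_def)
  then have bag: "bag t \<subseteq> verts G" using td by (auto simp: tree_decomposition_def)
  then have "finite (bag t)" using G by (auto simp: multigraph_def intro: finite_subset)
  then have "card ?Z \<le> card (bag t)" by (auto intro: card_mono)
  also have "\<dots> \<le> width T bag + 1" using card_bag_le_width[OF td t] .
  finally have Z: "card ?Z \<le> width T bag + 1" .
  have "card (incident_edges G ?Z) \<le> card ?Z * max_degree G"
    using card_incident_edges_le[OF G] bag by (meson inf.coboundedI1)
  also have "\<dots> \<le> (width T bag + 1) * max_degree G" using Z by (rule mult_le_mono1)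
  finally have le: "card (incident_edges G ?Z) \<le> (width T bag + 1) * max_degree G" .
  have "egg_cut_number G S \<le> enat (card (incident_edges G ?Z))"
    unfolding egg_cut_number_def
    using separated_egg_cut[OF td G S f A B] by (auto intro: INF_lower)
  then show ?thesis
    using le by (auto simp: scramble_order_def intro: min.coboundedI2 order_trans)
qed

theorem theorem1p6:
  fixes G :: "('v, 'e) mgraph"
  assumes "graph G" and "card (verts G) \<ge> 2"
  shows "scramble_number G \<le> enat ((treewidth G + 1) * max_degree G)"
proof -
  have G: "multigraph G" using assms(1) by (simp add: graph_def)
  have "\<exists>w (T :: (nat, nat) mgraph) bag. tree_decomposition G T bag \<and> width T bag = w"
    using tree_decomposition_exists[OF assms(1)] by blast
  \<comment> \<open>The one-node decomposition shows that some width occurs, so the least width is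
    attained.\<close>
  then have "\<exists>(T :: (nat, nat) mgraph) bag. tree_decomposition G T bag \<and> width T bag = treewidth G"
    unfolding treewidth_def by (rule LeastI_ex)
  then obtain T :: "(nat, nat) mgraph" and bag
    where td: "tree_decomposition G T bag" "width T bag = treewidth G" by blast
  have "scramble_order G S \<le> enat ((treewidth G + 1) * max_degree G)" if "scramble G S" for S
    using scramble_order_le_width[OF td(1) G that max_degree_pos[OF assms]] td(2) by simp
  then show ?thesis
    unfolding scramble_number_def
    using finite_scrambles[OF G] scramble_exists[OF assms(1)] by (subst Max_le_iff) auto
qed

end
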